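(* Let $X$ be a real Hilbert space and let $f,g:X\to(-\infty,+\infty]$ be proper $\Phi_{lsc}$-convex functions with $\operatorname{dom} f\cap\operatorname{dom} g\neq\emptyset$. Let $x^*\in X$ and let $\varphi^*=(a^*,w^* )\in\Phi_{lsc}$, with $a^*\ge0$, $w^*\in X$. Then $$\inf_{x\in X}(f(x)+g(x))=f(x^* )+g(x^* )=\sup_{a\ge0,\,w\in X}\Bigl(-(\tilde f_{(a,w)})_{\Phi_{lsc}}^*(0,-w)-g_{\Phi_{lsc}}^*(a,w)\Bigr)=-(\tilde f_{(a^*,w^* )})_{\Phi_{lsc}}^*(0,-w^* )-g_{\Phi_{lsc}}^*(a^*,w^* )$$ holds if and only if $$(0,-w^* )\in\partial_{lsc}\tilde f_{(a^*,w^* )}(x^* )\quad\text{and}\quad x^*\in\partial_X g_{\Phi_{lsc}}^*(\varphi^* ).$$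
   Context: $\Phi_{lsc}=\{\varphi:X\to\mathbb{R} \mid \varphi(x)=-a\|x\|^2+\langle v,x\rangle+c,\ a\ge0,\ v\in X,\ c\in\mathbb{R}\}$. The pair $(a,w)$ with $a\ge0$, $w\in X$ is identified with the function $x\mapsto-a\|x\|^2+\langle w,x\rangle$ in $\Phi_{lsc}$. For such a pair, $\tilde f_{(a,w)}(x):=f(x)-a\|x\|^2$. A function $h:X\to(-\infty,+\infty]$ is proper if $\operatorname{dom} h=\{x: h(x)<+\infty\}\ne\emptyset$, and is $\Phi_{lsc}$-convex if $h(x)=\sup\{\varphi(x):\varphi\in\Phi_{lsc},\ \varphi\le h\text{ on }X\}$ for all $x\in X$. Conjugate: $h_{\Phi_{lsc}}^*(\varphi)=\sup_{x\in X}(\varphi(x)-h(x))$ for $\varphi\in\Phi_{lsc}$; so $(\tilde f_{(a,w)})_{\Phi_{lsc}}^*(0,-w)=\sup_{x\in X}\{-\langle w,x\rangle-f(x)+a\|x\|^2\}$ and $g_{\Phi_{lsc}}^*(a,w)=\sup_{x\in X}\{-a\|x\|^2+\langle w,x\rangle-g(x)\}$. For $\bar x\in\operatorname{dom} h$, $\partial_{lsc}h(\bar x)=\{\varphi\in\Phi_{lsc}:h(x)-h(\bar x)\ge\varphi(x)-\varphi(\bar x)\ \forall x\in X\}$ (empty if $\bar x\notin\operatorname{dom} h$). For $\bar\varphi\in\Phi_{lsc}$ with $h_{\Phi_{lsc}}^*(\bar\varphi)<+\infty$ and $\bar x\in X$, $\bar x\in\partial_X h_{\Phi_{lsc}}^*(\bar\varphi)$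 means $h_{\Phi_{lsc}}^*(\varphi)-h_{\Phi_{lsc}}^*(\bar\varphi)\ge\varphi(\bar x)-\bar\varphi(\bar x)$ for all $\varphi\in\Phi_{lsc}$ (the set is empty if $h_{\Phi_{lsc}}^*(\bar\varphi)=+\infty$). *)

theory Defs
  imports "HOL-Analysis.Analysis"
begin

definition lsc_quad :: "real \<Rightarrow> 'a::real_inner \<Rightarrow> 'a \<Rightarrow> real" where
  "lsc_quad a w = (\<lambda>x. - a * (norm x)\<^sup>2 + w \<bullet> x)"

definition Phi_lsc :: "('a::real_inner \<Rightarrow> real) set" where
  "Phi_lsc = {\<lambda>x. - a * (norm x)\<^sup>2 + v \<bullet> x + c | a v c. 0 \<le> a}"

definition eff_dom :: "('a \<Rightarrow> ereal) \<Rightarrow> 'a set" where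
  "eff_dom h = {x. h x < \<infinity>}"

text \<open>The first conjunct restricts the codomain from \<open>ereal\<close> to \<open>(-\<infinity>, +\<infinity>]\<close>.\<close>

definition proper_fun :: "('a \<Rightarrow> ereal) \<Rightarrow> bool" where
  "proper_fun h \<longleftrightarrow> (\<forall>x. h x \<noteq> - \<infinity>) \<and> eff_dom h \<noteq> {}"

definition lsc_minorants :: "('a::real_inner \<Rightarrow> ereal) \<Rightarrow> ('a \<Rightarrow> real) set" where
  "lsc_minorants h = {\<phi> \<in> Phi_lsc. \<forall>x. ereal (\<phi> x) \<le> h x}"

definition Phi_lsc_convex :: "('a::real_inner \<Rightarrow> ereal) \<Rightarrow> bool" where
  "Phi_lsc_convex h \<longleftrightarrow> (\<forall>x. h x = (SUP \<phi>\<in>lsc_minorants h. ereal (\<phi> x)))"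

text \<open>Only used for arguments \<open>\<phi> \<in> Phi_lsc\<close>.\<close>

definition lsc_conj :: "('a::real_inner \<Rightarrow> ereal) \<Rightarrow> ('a \<Rightarrow> real) \<Rightarrow> ereal" where
  "lsc_conj h \<phi> = (SUP x. ereal (\<phi> x) - h x)"

text \<open>The function \<open>f\<close> shifted by the quadratic part of the pair \<open>(a, w)\<close>; it does not
  depend on \<open>w\<close>.\<close>

definition lsc_tilde :: "('a::real_inner \<Rightarrow> ereal) \<Rightarrow> real \<Rightarrow> 'a \<Rightarrow> 'a \<Rightarrow> ereal" where
  "lsc_tilde f a w = (\<lambda>x. f x - ereal (a * (norm x)\<^sup>2))"

definition lsc_subdiff :: "('a::real_inner \<Rightarrow> ereal) \<Rightarrow> 'a \<Rightarrow> ('a \<Rightarrow> real) set" where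
  "lsc_subdiff h z =
     {\<phi> \<in> Phi_lsc. z \<in> eff_dom h \<and> (\<forall>x. h x - h z \<ge> ereal (\<phi> x - \<phi> z))}"

text \<open>For proper \<open>h\<close> the conjugate never takes the value \<open>-\<infinity>\<close>, so
  \<open>lsc_conj h \<psi>\<close> is finite and the difference below is unambiguous.\<close>

definition lsc_conj_subdiff :: "('a::real_inner \<Rightarrow> ereal) \<Rightarrow> ('a \<Rightarrow> real) \<Rightarrow> 'a set" where
  "lsc_conj_subdiff h \<psi> =
     {z. lsc_conj h \<psi> < \<infinity> \<and>
         (\<forall>\<phi>\<in>Phi_lsc. lsc_conj h \<phi> - lsc_conj h \<psi> \<ge> ereal (\<phi> z - \<psi> z))}"

end

theory Submission
  imports Defs
begin

text \<open>Pointwise, the linear part of the first conjugate, the quadratic shift and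
  \<open>lsc_quad a w\<close> cancel, so adding the Fenchel-Young inequalities for the two conjugates gives weak
  duality. Finite equality therefore means equality in both Fenchel-Young inequalities at \<open>xs\<close>,
  that is, the two subdifferential conditions. For the conjugate subdifferential the passage from
  the condition to equality uses that \<open>g xs\<close> is the supremum of the values of its minorants,
  whose conjugates are nonpositive.\<close>

lemma lsc_quad_in_Phi_lsc: "0 \<le> a \<Longrightarrow> lsc_quad a w \<in> Phi_lsc"
  unfolding lsc_quad_def Phi_lsc_def
  by (rule CollectI, rule exI[of _ a], rule exI[of _ w], rule exI[of _ 0]) simp

lemma lsc_conj_upper: "ereal (\<phi> x) - h x \<le> lsc_conj h \<phi>"
  unfolding lsc_conj_def by (rule SUP_upper) simp

text \<open>A point where \<open>h\<close> is finite contributes a real term to the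
  supremum.\<close>

lemma lsc_conj_not_MInfty:
  assumes "proper_fun h"
  shows "lsc_conj h \<phi> \<noteq> - \<infinity>"
proof -
  obtain y where "h y < \<infinity>" "h y \<noteq> - \<infinity>"
    using assms unfolding proper_fun_def eff_dom_def by blast
  then show ?thesis
    using lsc_conj_upper[of \<phi> y h] by (cases "h y") auto
qed

lemma lsc_quad_cancel: "lsc_quad 0 (- w) x + a * (norm x)\<^sup>2 + lsc_quad a w x = 0"
  by (simp add: lsc_quad_def)

text \<open>To be read with \<open>u = f x\<close>, \<open>v = g x\<close>, the conjugates
  \<open>F\<close> and \<open>G\<close>, and the cancelling terms \<open>p\<close>,
  \<open>q\<close>, \<open>r\<close>. If \<open>u\<close> or \<open>v\<close> is
  \<open>\<infinity>\<close>, so is \<open>u + v\<close>; otherwise both lower bounds are real and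
  can be added.\<close>

lemma ereal_sum_of_lower_bounds:
  fixes u v F G :: ereal and p q r :: real
  assumes "p + q + r = 0" "u \<noteq> - \<infinity>" "v \<noteq> - \<infinity>"
    and "ereal p - (u - ereal q) \<le> F" "ereal r - v \<le> G"
  shows "- F - G \<le> u + v"
  using assms by (cases u; cases v; cases F; cases G) simp_all

text \<open>For real values, a sum of two inequalities is tight exactly when both are. Finiteness of
  \<open>u + v\<close> is part of the condition: with \<open>u = \<infinity>\<close> and
  \<open>F = - \<infinity>\<close>, the sums can agree at \<open>\<infinity>\<close> while the bound
  on \<open>G\<close> is strict.\<close>

lemma ereal_sum_of_lower_bounds_eq_iff:
  fixes u v F G :: ereal and p q r :: real
  assumes "p + q + r = 0" "u \<noteq> - \<infinity>" "v \<noteq> - \<infinity>"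
    and "ereal p - (u - ereal q) \<le> F" "ereal r - v \<le> G"
  shows "u + v < \<infinity> \<and> u + v = - F - G \<longleftrightarrow>
    u - ereal q < \<infinity> \<and> F = ereal p - (u - ereal q) \<and> v < \<infinity> \<and> G = ereal r - v"
  using assms by (cases u; cases v; cases F; cases G) auto

lemma lsc_conj_lsc_tilde_upper:
  "ereal (\<phi> x) - (f x - ereal (a * (norm x)\<^sup>2)) \<le> lsc_conj (lsc_tilde f a w) \<phi>"
  using lsc_conj_upper[of \<phi> x "lsc_tilde f a w"] by (simp only: lsc_tilde_def)

lemma weak_duality:
  assumes "f x \<noteq> - \<infinity>" "g x \<noteq> - \<infinity>"
  shows "- lsc_conj (lsc_tilde f a w) (lsc_quad 0 (- w)) - lsc_conj g (lsc_quad a w) \<le> f x + g x"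
  by (rule ereal_sum_of_lower_bounds[OF lsc_quad_cancel[of w x a] assms
        lsc_conj_lsc_tilde_upper[of "lsc_quad 0 (- w)" x f a w] lsc_conj_upper[of "lsc_quad a w" x g]])

text \<open>Rearranged, the subgradient inequality says that \<open>z\<close> maximizes
  \<open>\<phi> - h\<close>, so the supremum in the conjugate is attained there.\<close>

lemma lsc_subdiff_iff_conj_eq:
  assumes "\<And>x. h x \<noteq> - \<infinity>"
  shows "\<phi> \<in> lsc_subdiff h z \<longleftrightarrow>
    \<phi> \<in> Phi_lsc \<and> h z < \<infinity> \<and> lsc_conj h \<phi> = ereal (\<phi> z) - h z"
proof (cases "h z < \<infinity>")
  case True
  then obtain r where r: "h z = ereal r" using assms[of z] by (cases "h z") auto
  have "(ereal (\<phi> x - \<phi> z) \<le> h x - h z) = (ereal (\<phi> x) - h x \<le> ereal (\<phi> z) - h z)" for x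
    using assms[of x] r by (cases "h x") auto
  then have "(\<forall>x. ereal (\<phi> x - \<phi> z) \<le> h x - h z) \<longleftrightarrow> lsc_conj h \<phi> \<le> ereal (\<phi> z) - h z"
    by (simp add: lsc_conj_def SUP_le_iff)
  then show ?thesis
    using True lsc_conj_upper[of \<phi> z h] by (auto simp: lsc_subdiff_def eff_dom_def intro: antisym)
qed (auto simp: lsc_subdiff_def eff_dom_def)

lemma lsc_conj_subdiff_iff_conj_eq:
  assumes g: "proper_fun g" "Phi_lsc_convex g"
  shows "z \<in> lsc_conj_subdiff g \<psi> \<longleftrightarrow>
    g z < \<infinity> \<and> lsc_conj g \<psi> = ereal (\<psi> z) - g z"
proof
  assume z: "z \<in> lsc_conj_subdiff g \<psi>"
  then obtain c where c: "lsc_conj g \<psi> = ereal c"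
    using lsc_conj_not_MInfty[OF g(1), of \<psi>]
    by (cases "lsc_conj g \<psi>") (auto simp: lsc_conj_subdiff_def)
  \<comment> \<open>The minorants of \<open>g\<close> serve as test functions in the subgradient
    inequality of the conjugate.\<close>
  have "ereal (\<phi> z) \<le> ereal (\<psi> z - c)" if "\<phi> \<in> lsc_minorants g" for \<phi>
  proof -
    have "ereal (\<phi> x) - g x \<le> 0" for x
      using that by (cases "g x") (auto simp: lsc_minorants_def dest: spec[of _ x])
    then have "lsc_conj g \<phi> \<le> 0" by (simp add: lsc_conj_def SUP_le_iff)
    moreover have "ereal (\<phi> z - \<psi> z) \<le> lsc_conj g \<phi> - lsc_conj g \<psi>"
      using z that by (auto simp: lsc_conj_subdiff_def lsc_minorants_def)
    ultimately show ?thesis using c by (cases "lsc_conj g \<phi>") auto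
  qed
  moreover have "g z = (SUP \<phi>\<in>lsc_minorants g. ereal (\<phi> z))"
    using g(2) by (auto simp: Phi_lsc_convex_def)
  ultimately have "g z \<le> ereal (\<psi> z - c)" by (simp add: SUP_le_iff)
  \<comment> \<open>The supremum over minorants gives one inequality, Fenchel-Young at
    \<open>z\<close> the other.\<close>
  then show "g z < \<infinity> \<and> lsc_conj g \<psi> = ereal (\<psi> z) - g z"
    using c g(1) lsc_conj_upper[of \<psi> z g] by (cases "g z") (auto simp: proper_fun_def)
next
  assume z: "g z < \<infinity> \<and> lsc_conj g \<psi> = ereal (\<psi> z) - g z"
  then obtain r where r: "g z = ereal r"
    using g(1) by (cases "g z") (auto simp: proper_fun_def)
  \<comment> \<open>Fenchel-Young for \<open>\<phi>\<close> at \<open>z\<close>, minus the equality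
    for \<open>\<psi>\<close>.\<close>
  have "ereal (\<phi> z - \<psi> z) \<le> lsc_conj g \<phi> - lsc_conj g \<psi>" for \<phi>
    using z r lsc_conj_upper[of \<phi> z g] by (cases "lsc_conj g \<phi>") auto
  then show "z \<in> lsc_conj_subdiff g \<psi>" using z r by (auto simp: lsc_conj_subdiff_def)
qed

lemma strong_duality_iff_conj_eq:
  assumes "f x \<noteq> - \<infinity>" "g x \<noteq> - \<infinity>"
  shows "f x + g x < \<infinity> \<and>
      f x + g x = - lsc_conj (lsc_tilde f a w) (lsc_quad 0 (- w)) - lsc_conj g (lsc_quad a w)
    \<longleftrightarrow> lsc_tilde f a w x < \<infinity> \<and>
      lsc_conj (lsc_tilde f a w) (lsc_quad 0 (- w)) =
        ereal (lsc_quad 0 (- w) x) - lsc_tilde f a w x \<and>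
      g x < \<infinity> \<and> lsc_conj g (lsc_quad a w) = ereal (lsc_quad a w x) - g x"
  using ereal_sum_of_lower_bounds_eq_iff[OF lsc_quad_cancel[of w x a] assms
      lsc_conj_lsc_tilde_upper[of "lsc_quad 0 (- w)" x f a w] lsc_conj_upper[of "lsc_quad a w" x g]]
  by (simp only: lsc_tilde_def)

theorem theorem7p4:
  fixes f g :: "'a::{real_inner, complete_space} \<Rightarrow> ereal"
    and xs ws :: 'a and as :: real
  assumes "proper_fun f" and "Phi_lsc_convex f"
    and "proper_fun g" and "Phi_lsc_convex g"
    and "eff_dom f \<inter> eff_dom g \<noteq> {}"
    and "0 \<le> as"
  shows "((INF x. f x + g x) = f xs + g xs \<and>
          f xs + g xs =
            (SUP (a, w) \<in> {0..} \<times> UNIV.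
               - lsc_conj (lsc_tilde f a w) (lsc_quad 0 (- w)) - lsc_conj g (lsc_quad a w)) \<and>
          (SUP (a, w) \<in> {0..} \<times> UNIV.
               - lsc_conj (lsc_tilde f a w) (lsc_quad 0 (- w)) - lsc_conj g (lsc_quad a w)) =
            - lsc_conj (lsc_tilde f as ws) (lsc_quad 0 (- ws)) - lsc_conj g (lsc_quad as ws))
     \<longleftrightarrow>
         (lsc_quad 0 (- ws) \<in> lsc_subdiff (lsc_tilde f as ws) xs \<and>
          xs \<in> lsc_conj_subdiff g (lsc_quad as ws))"
proof -
  let ?D = "\<lambda>a w. - lsc_conj (lsc_tilde f a w) (lsc_quad 0 (- w)) - lsc_conj g (lsc_quad a w)"
  let ?S = "SUP (a, w) \<in> {0..} \<times> UNIV. ?D a w"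
  have nf: "f x \<noteq> - \<infinity>" and ng: "g x \<noteq> - \<infinity>" for x
    using assms(1,3) by (auto simp: proper_fun_def)
  have nt: "lsc_tilde f as ws x \<noteq> - \<infinity>" for x
    using nf[of x] by (cases "f x") (auto simp: lsc_tilde_def)
  have S_le: "?S \<le> (INF x. f x + g x)"
    by (auto intro!: SUP_least INF_greatest weak_duality nf ng)
  have D_le: "?D as ws \<le> ?S"
    using assms(6) by (intro SUP_upper2[of "(as, ws)"]) auto
  have I_le: "(INF x. f x + g x) \<le> f xs + g xs"
    by (rule INF_lower) simp
  obtain y where "f y < \<infinity>" "g y < \<infinity>"
    using assms(5) by (auto simp: eff_dom_def)
  then have "f y + g y < \<infinity>" by simp
  \<comment> \<open>This excludes a common value \<open>\<infinity>\<close> in the chain of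
    equalities, which the subdifferential conditions could not match.\<close>
  then have I_fin: "(INF x. f x + g x) < \<infinity>"
    by (rule le_less_trans[OF INF_lower, rotated]) simp
  \<comment> \<open>Always
    \<open>?D as ws \<le> ?S \<le> (INF x. f x + g x) \<le> f xs + g xs\<close>, so equality of the
    two ends collapses the whole chain.\<close>
  have "((INF x. f x + g x) = f xs + g xs \<and> f xs + g xs = ?S \<and> ?S = ?D as ws)
      \<longleftrightarrow> f xs + g xs < \<infinity> \<and> f xs + g xs = ?D as ws"
  proof
    assume "(INF x. f x + g x) = f xs + g xs \<and> f xs + g xs = ?S \<and> ?S = ?D as ws"
    then show "f xs + g xs < \<infinity> \<and> f xs + g xs = ?D as ws"
      using I_fin by metis
  next
    assume "f xs + g xs < \<infinity> \<and> f xs + g xs = ?D as ws"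
    then have eq: "f xs + g xs = ?D as ws" ..
    have "f xs + g xs \<le> ?S" unfolding eq by (rule D_le)
    then have "f xs + g xs = ?S" "(INF x. f x + g x) = f xs + g xs"
      using S_le I_le by order+
    then show "(INF x. f x + g x) = f xs + g xs \<and> f xs + g xs = ?S \<and> ?S = ?D as ws"
      using eq by simp
  qed
  also have "\<dots> \<longleftrightarrow> lsc_quad 0 (- ws) \<in> lsc_subdiff (lsc_tilde f as ws) xs \<and>
      xs \<in> lsc_conj_subdiff g (lsc_quad as ws)"
    using strong_duality_iff_conj_eq[of f xs g as ws, OF nf ng]
    by (simp add: lsc_subdiff_iff_conj_eq[OF nt] lsc_conj_subdiff_iff_conj_eq[OF assms(3,4)]
        lsc_quad_in_Phi_lsc)
  finally show ?thesis .
qed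

end
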